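(* Let $T_n$ be a real symmetric Toeplitz matrix of size $n$ and let $H_n=Y_nT_n$. Then the following properties hold. 1. There exists an orthonormal basis of $\mathbb R^n$ consisting of eigenvectors of $T_n$ such that $\lceil n/2\rceil$ vectors of this basis are symmetric and the other $\lfloor n/2\rfloor$ vectors are skew-symmetric. 2. Let $\{v_1,\ldots,v_n\}$ be a basis of $\mathbb R^n$ such that $T_nv_i=\lambda_i(T_n)v_i$ for $i=1,\ldots,n$ (where $\lambda_i(T_n)$ denotes the eigenvalue of $T_n$ associated with $v_i$), and such that $v_i$ is symmetric for every odd $i$ and skew-symmetric for every even $i$. Then the eigenpairs of $H_n$ are $(\lambda_i(H_n),v_i)$, $i=1,\ldots,n$, with $$\lambda_i(H_n)=(-1)^{i+1}\lambda_i(T_n),\qquad i=1,\ldots,n.$$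
   Context: $Y_n$ is the $n\times n$ flip matrix, with ones on the main antidiagonal and zeros elsewhere: $(Y_n)_{i,j}=1$ if $i+j=n+1$ and $0$ otherwise. A vector $v\in\mathbb R^n$ is called symmetric if $Y_nv=v$ and skew-symmetric if $Y_nv=-v$. *)

theory Defs
  imports
    Complex_Main
    "Jordan_Normal_Form.VS_Connect"
    "Jordan_Normal_Form.Char_Poly"
begin

(* Matrix and vector entries are indexed from 0, so the 1-based condition i + j = n + 1
   becomes i + j + 1 = n. *)
definition flip_mat :: "nat \<Rightarrow> real mat" where
  "flip_mat n = mat n n (\<lambda>(i, j). if i + j + 1 = n then 1 else 0)"

definition symmetric_vec :: "nat \<Rightarrow> real vec \<Rightarrow> bool" where
  "symmetric_vec n v \<longleftrightarrow> v \<in> carrier_vec n \<and> flip_mat n *\<^sub>v v = v"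

definition skew_symmetric_vec :: "nat \<Rightarrow> real vec \<Rightarrow> bool" where
  "skew_symmetric_vec n v \<longleftrightarrow> v \<in> carrier_vec n \<and> flip_mat n *\<^sub>v v = - v"

definition toeplitz_mat :: "nat \<Rightarrow> real mat \<Rightarrow> bool" where
  "toeplitz_mat n A \<longleftrightarrow> A \<in> carrier_mat n n \<and>
     (\<exists>t :: int \<Rightarrow> real. \<forall>i<n. \<forall>j<n. A $$ (i, j) = t (int i - int j))"

definition symmetric_mat :: "real mat \<Rightarrow> bool" where
  "symmetric_mat A \<longleftrightarrow> A\<^sup>T = A"

abbreviation basis_Rn :: "nat \<Rightarrow> real vec set \<Rightarrow> bool" where
  "basis_Rn n B \<equiv> vectorspace.basis class_ring (module_vec TYPE(real) n) B"

definition orthonormal_basis_Rn :: "nat \<Rightarrow> real vec set \<Rightarrow> bool" where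
  "orthonormal_basis_Rn n B \<longleftrightarrow> basis_Rn n B \<and>
     (\<forall>u\<in>B. \<forall>v\<in>B. u \<bullet> v = (if u = v then 1 else 0))"

end

theory Submission
  imports
    Defs
    "Jordan_Normal_Form.Schur_Decomposition"
    "Jordan_Normal_Form.Spectral_Radius"
    "Jordan_Normal_Form.DL_Rank"
begin

text \<open>The flip matrix $Y$ commutes with $T$, so $T + cY$ is symmetric. For $c$ large, every
  eigenvector of $T + cY$ is an eigenvector of both $T$ and $Y$, and the spectral theorem for
  $T + cY$ yields the required orthonormal basis. The number of symmetric minus the number of
  skew-symmetric basis vectors is the trace of $Y$, that is $n \bmod 2$.\<close>

section \<open>Spectral theorem for real symmetric matrices\<close>

text \<open>Over the complex numbers an eigenpair always exists. The Hermitian form of a real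
  symmetric matrix takes real values, which forces the eigenvalue to be real.\<close>

lemma symmetric_mat_eigenvalue_exists:
  fixes A :: "real mat"
  assumes A: "A \<in> carrier_mat n n" and sym: "A\<^sup>T = A" and n: "n > 0"
  shows "\<exists>e. eigenvalue A e"
proof -
  define C where "C = map_mat complex_of_real A"
  have C: "C \<in> carrier_mat n n" using A by (simp add: C_def)
  have Aij: "A $$ (i,j) = A $$ (j,i)" if "i < n" "j < n" for i j
    using arg_cong[OF sym, of "\<lambda>M. M $$ (i,j)"] A that by simp
  obtain m x where x: "x \<in> carrier_vec n" "x \<noteq> 0\<^sub>v n" and ev: "C *\<^sub>v x = m \<cdot>\<^sub>v x"
    using spectrum_non_empty[OF C n] C by (auto simp: spectrum_def eigenvalue_def eigenvector_def)
  \<comment> \<open>Here \<open>s\<close> is the Hermitian form of \<open>A\<close> at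
    \<open>x\<close>, and \<open>r\<close> is the squared norm of \<open>x\<close>. The eigenvalue
    equation gives \<open>s = m * r\<close>, and the symmetry of \<open>A\<close> makes
    \<open>s\<close> its own conjugate.\<close>
  define s where "s = (\<Sum>i<n. \<Sum>j<n. complex_of_real (A $$ (i,j)) * cnj (x $ i) * x $ j)"
  define r where "r = (\<Sum>i<n. (cmod (x $ i))\<^sup>2)"
  have row: "(\<Sum>j<n. complex_of_real (A $$ (i,j)) * x $ j) = m * x $ i" if "i < n" for i
    using arg_cong[OF ev, of "\<lambda>v. v $ i"] that A x
    by (simp add: C_def scalar_prod_def lessThan_atLeast0)
  have "s = (\<Sum>i<n. cnj (x $ i) * (\<Sum>j<n. complex_of_real (A $$ (i,j)) * x $ j))"
    by (simp add: s_def sum_distrib_left mult_ac)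
  also have "\<dots> = (\<Sum>i<n. m * complex_of_real ((cmod (x $ i))\<^sup>2))"
    by (intro sum.cong refl, subst row)
      (auto simp: complex_norm_square mult.assoc mult.left_commute mult.commute simp del: of_real_power)
  finally have s: "s = m * complex_of_real r" by (simp add: r_def sum_distrib_left)
  have "cnj s = (\<Sum>i<n. \<Sum>j<n. complex_of_real (A $$ (i,j)) * cnj (x $ j) * x $ i)"
    by (simp add: s_def cnj_sum mult_ac)
  also have "\<dots> = s" unfolding s_def
    by (subst sum.swap) (intro sum.cong refl, simp add: Aij)
  finally have "cnj m * complex_of_real r = m * complex_of_real r" by (simp add: s)
  moreover have "r \<noteq> 0"
  proof
    assume "r = 0"
    hence "\<forall>i<n. x $ i = 0" by (simp add: r_def sum_nonneg_eq_0_iff)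
    hence "x = 0\<^sub>v n" using x by (intro eq_vecI) auto
    with x show False by simp
  qed
  ultimately have "m \<in> \<real>" using Reals_cnj_iff by simp
  then obtain e where e: "m = complex_of_real e" by (elim Reals_cases)
  \<comment> \<open>This only shows \<open>m\<close> to be an eigenvalue of the complexification.
    Passing through the characteristic polynomial, whose coefficients are real, brings the root
    \<open>e\<close> back to \<open>A\<close> and yields a real eigenvector.\<close>
  have "eigenvalue C m" using x ev C by (auto simp: eigenvalue_def eigenvector_def)
  hence "poly (char_poly C) m = 0" using eigenvalue_root_char_poly[OF C] by simp
  hence "poly (map_poly complex_of_real (char_poly A)) (complex_of_real e) = 0"
    using of_real_hom.char_poly_hom[OF A, where 'a = complex] by (simp add: C_def e)
  hence "poly (char_poly A) e = 0" by (simp add: of_real_hom.poly_map_poly)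
  thus ?thesis using eigenvalue_root_char_poly[OF A] by blast
qed

text \<open>Complete \<open>v\<close> to a basis, apply Gram-Schmidt, which leaves the first vector
  unchanged, and normalise. The factor \<open>c\<close> is the reciprocal of the norm of
  \<open>v\<close>.\<close>

lemma orthonormal_mat_with_first_col:
  fixes v :: "real vec"
  assumes v: "v \<in> carrier_vec n" and v0: "v \<noteq> 0\<^sub>v n"
  shows "\<exists>W c. W \<in> carrier_mat n n \<and> W\<^sup>T * W = 1\<^sub>m n \<and> col W 0 = c \<cdot>\<^sub>v v"
proof -
  interpret cof_vec_space n "TYPE(real)" .
  have n: "n > 0" using v v0 by (cases n) auto
  define b where "b = basis_completion v"
  define ws where "ws = gram_schmidt n b"
  note b = basis_completion[OF v v0, folded b_def]
  obtain vs where bv: "b = v # vs" using b(6,7) n by (cases b) auto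
  note gs = gram_schmidt_result[OF b(2,4,5) refl, folded ws_def]
  have len: "length ws = n" using gs(4) b(6) by simp
  have hd: "ws ! 0 = v"
    using gram_schmidt_hd[OF v, of vs] len n hd_conv_nth[of ws] unfolding ws_def bv by force
  have wsc: "ws ! i \<in> carrier_vec n" if "i < n" for i using gs(3) len that by auto
  \<comment> \<open>The case \<open>i = j\<close> says that no \<open>ws ! i\<close> has norm zero,
    so the normalising factors \<open>f i\<close> below make sense.\<close>
  have orth: "ws ! i \<bullet> ws ! j = 0 \<longleftrightarrow> i \<noteq> j" if "i < n" "j < n" for i j
    using corthogonalD[OF gs(2), of i j] that len by simp
  define f where "f i = 1 / sqrt (ws ! i \<bullet> ws ! i)" for i
  define us where "us = map (\<lambda>i. f i \<cdot>\<^sub>v ws ! i) [0..<n]"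
  define W where "W = mat_of_cols n us"
  have W: "W \<in> carrier_mat n n" by (simp add: W_def us_def mat_of_cols_def)
  have colW: "col W i = f i \<cdot>\<^sub>v ws ! i" if "i < n" for i
    using that wsc by (simp add: W_def us_def)
  have "W\<^sup>T * W = 1\<^sub>m n"
  proof (rule eq_matI)
    fix i j assume "i < dim_row (1\<^sub>m n :: real mat)" "j < dim_col (1\<^sub>m n :: real mat)"
    hence ij: "i < n" "j < n" by auto
    have "ws ! i \<bullet> ws ! i \<ge> 0" using wsc[OF ij(1)] by (simp add: scalar_prod_def sum_nonneg)
    moreover have "ws ! i \<bullet> ws ! i \<noteq> 0" using orth[of i i] ij by simp
    ultimately have "f i * f i * (ws ! i \<bullet> ws ! i) = 1" by (simp add: f_def)
    moreover have "(W\<^sup>T * W) $$ (i,j) = f i * f j * (ws ! i \<bullet> ws ! j)"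
      using W ij wsc[OF ij(1)] wsc[OF ij(2)]
      by (simp add: colW smult_scalar_prod_distrib[of _ n] scalar_prod_smult_distrib[of _ n])
    ultimately show "(W\<^sup>T * W) $$ (i,j) = 1\<^sub>m n $$ (i,j)" using orth[of i j] ij by auto
  qed (use W in auto)
  thus ?thesis using W colW[OF n] hd by auto
qed

text \<open>Deflation: in an orthonormal basis that starts with an eigenvector, the symmetric matrix
  splits into a 1 by 1 block and a symmetric block \<open>F\<close> of size \<open>n\<close>, to
  which the induction hypothesis applies.\<close>

theorem real_symmetric_diagonalization:
  fixes A :: "real mat"
  assumes "A \<in> carrier_mat n n" and "A\<^sup>T = A"
  shows "\<exists>P D. P \<in> carrier_mat n n \<and> D \<in> carrier_mat n n \<and> P\<^sup>T * P = 1\<^sub>m n \<and>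
    diagonal_mat D \<and> A * P = P * D"
  using assms
proof (induction n arbitrary: A)
  case 0
  show ?case
    by (rule exI[of _ "1\<^sub>m 0"], rule exI[of _ "1\<^sub>m 0"]) (use 0 in \<open>auto simp: diagonal_mat_def\<close>)
next
  case (Suc n)
  let ?N = "Suc n"
  note A = Suc.prems(1)
  obtain e v where ev: "v \<in> carrier_vec ?N" "v \<noteq> 0\<^sub>v ?N" "A *\<^sub>v v = e \<cdot>\<^sub>v v"
    using symmetric_mat_eigenvalue_exists[OF Suc.prems] A by (auto simp: eigenvalue_def eigenvector_def)
  obtain W c where W: "W \<in> carrier_mat ?N ?N" and WW: "W\<^sup>T * W = 1\<^sub>m ?N" and W0: "col W 0 = c \<cdot>\<^sub>v v"
    using orthonormal_mat_with_first_col[OF ev(1,2)] by blast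
  have WW': "W * W\<^sup>T = 1\<^sub>m ?N"
    using mat_mult_left_right_inverse[of "W\<^sup>T" ?N W] W WW by simp
  define E where "E = W\<^sup>T * (A * W)"
  have E: "E \<in> carrier_mat ?N ?N" using A W by (simp add: E_def)
  have WE: "W * E = A * W"
    unfolding E_def using A W WW' assoc_mult_mat[of W ?N ?N "W\<^sup>T" ?N "A * W" ?N] by simp
  have Esym: "E\<^sup>T = E"
  proof -
    have "E\<^sup>T = (W\<^sup>T * A\<^sup>T) * W"
      unfolding E_def using A W by (simp add: transpose_mult[of _ ?N ?N _ ?N])
    thus ?thesis using A W Suc.prems(2) by (simp add: E_def assoc_mult_mat[of _ ?N ?N _ ?N _ ?N])
  qed
  have Eij: "E $$ (i,j) = E $$ (j,i)" if "i < ?N" "j < ?N" for i j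
    using arg_cong[OF Esym, of "\<lambda>M. M $$ (i,j)"] E that by simp
  have "col (A * W) 0 = e \<cdot>\<^sub>v col W 0"
    using ev by (simp only: col_mult2[OF A W zero_less_Suc] W0 mult_mat_vec[OF A ev(1)]
      smult_smult_assoc mult.commute)
  \<comment> \<open>The first column of \<open>E\<close> is \<open>W\<^sup>T\<close> applied to
    \<open>e\<close> times the first column of \<open>W\<close>, hence \<open>e\<close> times the
    first unit vector. The symmetry \<open>Eij\<close> then clears the first row as well.\<close>
  hence Ei0: "E $$ (i,0) = (if i = 0 then e else 0)" if "i < ?N" for i
    using A W that arg_cong[OF WW, of "\<lambda>M. M $$ (i,0)"] by (simp add: E_def)
  define F where "F = mat n n (\<lambda>(i,j). E $$ (Suc i, Suc j))"
  have F: "F \<in> carrier_mat n n" by (simp add: F_def)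
  have Eblock: "E = four_block_mat (mat 1 1 (\<lambda>_. e)) (0\<^sub>m 1 n) (0\<^sub>m n 1) F"
  proof (rule eq_matI)
    fix i j
    assume "i < dim_row (four_block_mat (mat 1 1 (\<lambda>_. e)) (0\<^sub>m 1 n) (0\<^sub>m n 1) F)"
      "j < dim_col (four_block_mat (mat 1 1 (\<lambda>_. e)) (0\<^sub>m 1 n) (0\<^sub>m n 1) F)"
    hence "i < ?N" "j < ?N" by (auto simp: F_def)
    thus "E $$ (i,j) = four_block_mat (mat 1 1 (\<lambda>_. e)) (0\<^sub>m 1 n) (0\<^sub>m n 1) F $$ (i,j)"
      using Ei0[of i] Ei0[of j] Eij[of i j] by (cases i; cases j) (auto simp: F_def)
  qed (use E in \<open>auto simp: F_def\<close>)
  have "F\<^sup>T = F" by (rule eq_matI) (auto simp: F_def Eij)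
  then obtain Q G where Q: "Q \<in> carrier_mat n n" and G: "G \<in> carrier_mat n n"
    and QQ: "Q\<^sup>T * Q = 1\<^sub>m n" and Gd: "diagonal_mat G" and FQ: "F * Q = Q * G"
    using Suc.IH[OF F] by blast
  \<comment> \<open>The change of basis \<open>Q\<close> for \<open>F\<close> is extended by a
    leading 1, which fixes the eigenvector already found. The diagonalising matrix for
    \<open>A\<close> is then \<open>W * R\<close>.\<close>
  define R where "R = four_block_mat (1\<^sub>m 1) (0\<^sub>m 1 n) (0\<^sub>m n 1) Q"
  define D where "D = four_block_mat (mat 1 1 (\<lambda>_. e)) (0\<^sub>m 1 n) (0\<^sub>m n 1) G"
  have R: "R \<in> carrier_mat ?N ?N"
    unfolding R_def using four_block_carrier_mat[OF one_carrier_mat Q, of 1] by simp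
  have D: "D \<in> carrier_mat ?N ?N"
    unfolding D_def using four_block_carrier_mat[OF _ G, of _ 1 1] by simp
  have "R\<^sup>T = four_block_mat (1\<^sub>m 1) (0\<^sub>m 1 n) (0\<^sub>m n 1) (Q\<^sup>T)"
    unfolding R_def using Q by (subst transpose_four_block_mat) auto
  hence "R\<^sup>T * R = four_block_mat (1\<^sub>m 1) (0\<^sub>m 1 n) (0\<^sub>m n 1) (Q\<^sup>T) *
      four_block_mat (1\<^sub>m 1) (0\<^sub>m 1 n) (0\<^sub>m n 1) Q"
    by (simp only: R_def[symmetric])
  also have "\<dots> = four_block_mat (1\<^sub>m 1) (0\<^sub>m 1 n) (0\<^sub>m n 1) (1\<^sub>m n)"
    using Q QQ by (subst mult_four_block_mat[of _ 1 1 _ n _ n _ _ 1 _ n]) auto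
  also have "\<dots> = 1\<^sub>m ?N" by (rule eq_matI) auto
  finally have RR: "R\<^sup>T * R = 1\<^sub>m ?N" .
  have ER: "E * R = R * D"
    unfolding Eblock R_def D_def using Q F G FQ
    by (subst mult_four_block_mat[of _ 1 1 _ n _ n _ _ 1 _ n], simp_all)
      (subst mult_four_block_mat[of _ 1 1 _ n _ n _ _ 1 _ n], simp_all)
  have "diagonal_mat D" unfolding diagonal_mat_def
  proof (intro allI impI)
    fix i j assume "i < dim_row D" "j < dim_col D" "i \<noteq> j"
    thus "D $$ (i,j) = 0" using D G Gd by (cases i; cases j) (auto simp: D_def diagonal_mat_def)
  qed
  moreover have "(W * R)\<^sup>T * (W * R) = 1\<^sub>m ?N"
  proof -
    have "(W * R)\<^sup>T * (W * R) = R\<^sup>T * ((W\<^sup>T * W) * R)"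
      using W R by (simp add: transpose_mult[of _ ?N ?N _ ?N] assoc_mult_mat[of _ ?N ?N _ ?N _ ?N])
    thus ?thesis using R by (simp add: WW RR)
  qed
  moreover have "A * (W * R) = (W * R) * D"
  proof -
    have "A * (W * R) = (W * E) * R"
      using W R A by (simp add: WE assoc_mult_mat[of _ ?N ?N _ ?N _ ?N])
    thus ?thesis using W R E D by (simp add: ER assoc_mult_mat[of _ ?N ?N _ ?N _ ?N])
  qed
  ultimately show ?case using W R D by (intro exI[of _ "W * R"] exI[of _ D]) auto
qed

section \<open>Matrices whose columns form a basis\<close>

text \<open>Two equal columns at different positions would have inner product both 0 and 1. The
  determinant of \<open>P\<close> is nonzero, so the \<open>n\<close> distinct columns are
  independent and hence a basis by dimension.\<close>

lemma orthogonal_mat_cols_basis: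
  fixes P :: "real mat"
  assumes P: "P \<in> carrier_mat n n" and PP: "P\<^sup>T * P = 1\<^sub>m n"
  shows "distinct (cols P)" "orthonormal_basis_Rn n (set (cols P))"
proof -
  interpret vec_space "TYPE(real)" n .
  have ip: "col P i \<bullet> col P j = (if i = j then 1 else 0)" if "i < n" "j < n" for i j
    using arg_cong[OF PP, of "\<lambda>M. M $$ (i,j)"] P that by simp
  show dist: "distinct (cols P)" unfolding distinct_conv_nth
  proof (intro allI impI)
    fix i j assume "i < length (cols P)" "j < length (cols P)" "i \<noteq> j"
    thus "cols P ! i \<noteq> cols P ! j" using P ip[of i i] ip[of i j] by auto
  qed
  have "det (P\<^sup>T) * det P = 1"
    using det_mult[of "P\<^sup>T" n P] P PP by simp
  hence "det P \<noteq> 0" by auto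
  hence li: "lin_indpt (set (cols P))"
    using idom_vec.lin_dep_cols_imp_det_0[OF P] by blast
  have "basis (set (cols P))"
    by (rule dim_li_is_basis) (use P li cols_dim[of P] dist in \<open>auto simp: dim_is_n distinct_card\<close>)
  moreover have "u \<bullet> v = (if u = v then 1 else 0)" if uv: "u \<in> set (cols P)" "v \<in> set (cols P)" for u v
  proof -
    obtain i j where "i < n" "u = col P i" "j < n" "v = col P j"
      using uv P by (auto simp: in_set_conv_nth)
    thus ?thesis using ip[of i j] ip[of i i] by auto
  qed
  ultimately show "orthonormal_basis_Rn n (set (cols P))" by (simp add: orthonormal_basis_Rn_def)
qed

text \<open>A basis has exactly \<open>n\<close> elements, so a list of length \<open>n\<close> that
  enumerates it has no repetitions. The matrix therefore has full rank.\<close>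

lemma basis_imp_invertible_mat_of_cols:
  fixes vs :: "real vec list"
  assumes b: "basis_Rn n (set vs)" and len: "length vs = n"
  shows "\<exists>W'. W' \<in> carrier_mat n n \<and> mat_of_cols n vs * W' = 1\<^sub>m n \<and> W' * mat_of_cols n vs = 1\<^sub>m n"
proof -
  interpret vec_space "TYPE(real)" n .
  define W where "W = mat_of_cols n vs"
  have W: "W \<in> carrier_mat n n" by (simp add: W_def len mat_of_cols_def)
  have carr: "set vs \<subseteq> carrier_vec n" and li: "lin_indpt (set vs)"
    using b by (auto simp: basis_def)
  have cW: "cols W = vs" unfolding W_def using carr by simp
  have "card (set vs) = n" using dim_basis[OF _ b] by (simp add: dim_is_n)
  hence "distinct vs" using len by (simp add: card_distinct)
  hence "rank W = n" using lin_indpt_full_rank[OF W] li by (simp add: cW)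
  hence "det W \<noteq> 0" using det_zero_low_rank[OF W] by auto
  thus ?thesis
    using det_non_zero_imp_unit[OF W, of "()"] by (auto simp: Units_def ring_mat_def W_def[symmetric])
qed

text \<open>With the basis as columns of \<open>W\<close>, the eigenvalue equations read
  \<open>A * W = W * D\<close> with \<open>D\<close> diagonal, so \<open>A\<close> is similar to
  \<open>D\<close>. The characteristic polynomial records that the \<open>c i\<close> are all the
  eigenvalues, with multiplicity.\<close>

lemma char_poly_eigenvector_basis:
  fixes A :: "real mat"
  assumes A: "A \<in> carrier_mat n n" and b: "basis_Rn n (v ` {1..n})"
    and ev: "\<And>i. i \<in> {1..n} \<Longrightarrow> A *\<^sub>v v i = c i \<cdot>\<^sub>v v i"
  shows "char_poly A = (\<Prod>i = 1..n. [:- c i, 1:])"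
    and "\<And>i. i \<in> {1..n} \<Longrightarrow> eigenvector A (v i) (c i)"
proof -
  interpret vec_space "TYPE(real)" n .
  define vs where "vs = map v [1..<Suc n]"
  have set_vs: "set vs = v ` {1..n}" unfolding vs_def by (auto simp del: upt_Suc)
  have len: "length vs = n" by (simp add: vs_def)
  \<comment> \<open>The basis is numbered from 1 and matrix columns from 0, hence the shift by
    \<open>Suc\<close> here and in \<open>D\<close>.\<close>
  have nth: "vs ! i = v (Suc i)" if "i < n" for i using that by (simp add: vs_def del: upt_Suc)
  define W where "W = mat_of_cols n vs"
  have W: "W \<in> carrier_mat n n" by (simp add: W_def len mat_of_cols_def)
  obtain W' where W': "W' \<in> carrier_mat n n" "W * W' = 1\<^sub>m n" "W' * W = 1\<^sub>m n"
    using basis_imp_invertible_mat_of_cols[of n vs] b by (auto simp: set_vs len W_def)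
  have carr: "v i \<in> carrier_vec n" if "i \<in> {1..n}" for i
    using b that by (auto simp: basis_def)
  have colW: "col W i = v (Suc i)" if "i < n" for i
    using that carr by (simp add: W_def len nth)
  define D where "D = mat n n (\<lambda>(i,j). if i = j then c (Suc i) else 0)"
  have D: "D \<in> carrier_mat n n" by (simp add: D_def)
  have AW: "A * W = W * D"
  proof (rule mat_col_eqI)
    fix j assume "j < dim_col (W * D)"
    hence j: "j < n" using D by simp
    have "col (A * W) j = c (Suc j) \<cdot>\<^sub>v v (Suc j)"
      using ev[of "Suc j"] j by (simp add: col_mult2[OF A W j] colW)
    also have "\<dots> = W *\<^sub>v col D j"
    proof (rule eq_vecI)
      fix i assume "i < dim_vec (W *\<^sub>v col D j)"
      hence i: "i < n" using W by simp
      have "(W *\<^sub>v col D j) $ i = (\<Sum>k<n. W $$ (i,k) * (if k = j then c (Suc k) else 0))"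
        using W D i j by (auto simp: scalar_prod_def lessThan_atLeast0 D_def intro!: sum.cong)
      also have "\<dots> = W $$ (i,j) * c (Suc j)"
        using j by (simp add: if_distrib[where f = "\<lambda>x. _ * x"] cong: if_cong)
      also have "W $$ (i,j) = v (Suc j) $ i"
        using arg_cong[OF colW[OF j], of "\<lambda>u. u $ i"] W i j by simp
      finally show "(c (Suc j) \<cdot>\<^sub>v v (Suc j)) $ i = (W *\<^sub>v col D j) $ i"
        using carr[of "Suc j"] i j by simp
    qed (use carr[of "Suc j"] W j in auto)
    also have "\<dots> = col (W * D) j" by (simp only: col_mult2[OF W D j])
    finally show "col (A * W) j = col (W * D) j" .
  qed (use A W D in auto)
  have "A = A * (W * W')" using A W' by simp
  also have "\<dots> = W * D * W'" using assoc_mult_mat[OF A W W'(1)] by (simp add: AW)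
  finally have "similar_mat A D"
    using A W W' D by (intro similar_matI[of _ _ W W' n]) auto
  hence "char_poly A = char_poly D" by (rule char_poly_similar)
  also have "\<dots> = (\<Prod>a\<leftarrow>diag_mat D. [:- a, 1:])"
    by (rule char_poly_upper_triangular[OF D]) (auto simp: D_def)
  also have "diag_mat D = map c [1..<Suc n]"
    by (rule nth_equalityI) (auto simp: D_def diag_mat_def simp del: upt_Suc)
  also have "(\<Prod>a\<leftarrow>map c [1..<Suc n]. [:- a, 1:]) = (\<Prod>i = 1..n. [:- c i, 1:])"
    by (simp add: o_def prod.distinct_set_conv_list[symmetric] atLeastLessThanSuc_atLeastAtMost del: upt_Suc)
  finally show "char_poly A = (\<Prod>i = 1..n. [:- c i, 1:])" .
  show "eigenvector A (v i) (c i)" if "i \<in> {1..n}" for i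
  proof -
    \<comment> \<open>An independent set excludes the zero vector because the scalars form a
      nontrivial ring.\<close>
    have "(UNIV :: real set) \<noteq> {0}" by (metis UNIV_I singletonD zero_neq_one)
    hence "0\<^sub>v n \<notin> v ` {1..n}" using b zero_nin_lin_indpt[of "v ` {1..n}"] by (simp add: basis_def)
    hence "v i \<noteq> 0\<^sub>v n" using that by (metis imageI)
    thus ?thesis using A carr[OF that] ev[OF that] by (auto simp: eigenvector_def)
  qed
qed

section \<open>The flip matrix: index reflection, commutation and trace\<close>

lemma flip_mat_carrier [simp]: "flip_mat n \<in> carrier_mat n n"
  by (simp add: flip_mat_def)

lemma flip_mat_dim [simp]: "dim_row (flip_mat n) = n" "dim_col (flip_mat n) = n"
  by (simp_all add: flip_mat_def)

lemma flip_mat_transpose: "(flip_mat n)\<^sup>T = flip_mat n"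
  by (rule eq_matI) (auto simp: flip_mat_def)

text \<open>Each column of the flip matrix has its single 1 in row \<open>n - 1 - j\<close>. This
  turns products with the flip matrix, on either side, into an index reflection.\<close>

lemma sum_flip:
  fixes f :: "nat \<Rightarrow> real"
  assumes "j < n"
  shows "(\<Sum>k = 0..<n. f k * (if k + j + 1 = n then 1 else 0)) = f (n - 1 - j)"
proof -
  have "(\<Sum>k = 0..<n. f k * (if k + j + 1 = n then 1 else 0)) =
      (\<Sum>k = 0..<n. if k = n - 1 - j then f k else 0)"
    using assms by (intro sum.cong) auto
  thus ?thesis using assms by simp
qed

lemma mult_flip_mat_index:
  assumes "A \<in> carrier_mat n n" "i < n" "j < n"
  shows "(A * flip_mat n) $$ (i,j) = A $$ (i, n - 1 - j)"
proof -
  have "(A * flip_mat n) $$ (i,j) = (\<Sum>k = 0..<n. A $$ (i,k) * (if k + j + 1 = n then 1 else 0))"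
    using assms by (auto simp: flip_mat_def scalar_prod_def intro!: sum.cong)
  thus ?thesis by (simp only: sum_flip[OF assms(3), of "\<lambda>k. A $$ (i,k)"])
qed

lemma flip_mat_mult_index:
  assumes "A \<in> carrier_mat n n" "i < n" "j < n"
  shows "(flip_mat n * A) $$ (i,j) = A $$ (n - 1 - i, j)"
proof -
  have "(flip_mat n * A) $$ (i,j) = (\<Sum>k = 0..<n. A $$ (k,j) * (if k + i + 1 = n then 1 else 0))"
    using assms by (auto simp: flip_mat_def scalar_prod_def intro!: sum.cong)
  thus ?thesis by (simp only: sum_flip[OF assms(2), of "\<lambda>k. A $$ (k,j)"])
qed

lemma flip_mat_square: "flip_mat n * flip_mat n = 1\<^sub>m n"
  by (rule eq_matI) (auto simp: flip_mat_mult_index[of _ n] simp del: index_mult_mat(1), auto simp: flip_mat_def)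

text \<open>Symmetry moves the entry at \<open>(i, n - 1 - j)\<close> to
  \<open>(n - 1 - j, i)\<close>. This position and \<open>(n - 1 - i, j)\<close> have the same index
  difference \<open>n - 1 - i - j\<close>, so they lie on the same Toeplitz diagonal.\<close>

lemma flip_mat_commute:
  assumes "toeplitz_mat n T" "symmetric_mat T"
  shows "T * flip_mat n = flip_mat n * T"
proof -
  obtain t where T: "T \<in> carrier_mat n n"
    and t: "\<And>i j. i < n \<Longrightarrow> j < n \<Longrightarrow> T $$ (i,j) = t (int i - int j)"
    using assms(1) by (auto simp: toeplitz_mat_def)
  have sym: "T $$ (i,j) = T $$ (j,i)" if "i < n" "j < n" for i j
    using arg_cong[OF assms(2)[unfolded symmetric_mat_def], of "\<lambda>M. M $$ (i,j)"] T that by simp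
  show ?thesis
  proof (rule eq_matI)
    fix i j assume "i < dim_row (flip_mat n * T)" "j < dim_col (flip_mat n * T)"
    hence ij: "i < n" "j < n" using T by auto
    have "T $$ (i, n - 1 - j) = T $$ (n - 1 - j, i)" using ij sym by simp
    also have "\<dots> = T $$ (n - 1 - i, j)" using ij by (simp add: t of_nat_diff algebra_simps)
    finally show "(T * flip_mat n) $$ (i,j) = (flip_mat n * T) $$ (i,j)"
      using T ij by (simp add: mult_flip_mat_index[of _ n] flip_mat_mult_index[of _ n] del: index_mult_mat(1))
  qed (use T in auto)
qed

lemma sum_diag_mult_commute:
  fixes A B :: "real mat"
  assumes "A \<in> carrier_mat n n" "B \<in> carrier_mat n n"
  shows "(\<Sum>i<n. (A * B) $$ (i,i)) = (\<Sum>i<n. (B * A) $$ (i,i))"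
proof -
  have "(\<Sum>i<n. (A * B) $$ (i,i)) = (\<Sum>i<n. \<Sum>k<n. A $$ (i,k) * B $$ (k,i))"
    using assms by (simp add: scalar_prod_def lessThan_atLeast0)
  also have "\<dots> = (\<Sum>i<n. \<Sum>k<n. B $$ (i,k) * A $$ (k,i))"
    by (subst sum.swap) (simp add: mult.commute)
  also have "\<dots> = (\<Sum>i<n. (B * A) $$ (i,i))"
    using assms by (simp add: scalar_prod_def lessThan_atLeast0)
  finally show ?thesis .
qed

text \<open>The two diagonals meet only where \<open>2 * i + 1 = n\<close>, that is, at the middle
  index \<open>n div 2\<close> of an odd \<open>n\<close>.\<close>

lemma sum_diag_flip_mat: "(\<Sum>i<n. flip_mat n $$ (i,i)) = real (n mod 2)"
proof -
  have "(\<Sum>i<n. flip_mat n $$ (i,i)) = (\<Sum>i<n. if i + i + 1 = n then 1 else 0)"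
    by (simp add: flip_mat_def)
  also have "\<dots> = (\<Sum>i<n. if i = n div 2 \<and> odd n then 1 else 0)"
    by (intro sum.cong refl if_cong) presburger
  also have "\<dots> = real (n mod 2)"
    by (cases "odd n") (auto simp: odd_iff_mod_2_eq_one)
  finally show ?thesis .
qed

section \<open>Joint eigenvectors of a matrix and a commuting involution\<close>

text \<open>The spectrum is finite, hence bounded; adding 1 to a bound makes it strict. This
  supplies the shift \<open>c\<close> used below.\<close>

lemma finite_eigenvalues_bound:
  fixes A :: "real mat"
  assumes A: "A \<in> carrier_mat n n"
  shows "\<exists>c. \<forall>k. eigenvalue A k \<longrightarrow> \<bar>k\<bar> < c"
proof -
  have "finite (spectrum A)" by (rule card_finite_spectrum(1)[OF A])
  hence "bdd_above (abs ` spectrum A)" by simp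
  then obtain b where "\<forall>k \<in> spectrum A. \<bar>k\<bar> \<le> b" by (auto simp: bdd_above_def)
  hence "\<forall>k. eigenvalue A k \<longrightarrow> \<bar>k\<bar> < b + 1"
    by (auto simp: spectrum_def intro: order_le_less_trans[OF _ less_add_one])
  thus ?thesis ..
qed

lemma smult_mat_mult_vec:
  fixes A :: "real mat"
  assumes "A \<in> carrier_mat n m" "v \<in> carrier_vec m"
  shows "(c \<cdot>\<^sub>m A) *\<^sub>v v = c \<cdot>\<^sub>v (A *\<^sub>v v)"
  using assms by (intro eq_vecI) auto

text \<open>For $c$ larger than every $|\lambda|$, the spectra $\lambda + c$ and $\lambda - c$ of
  $A + cY$ on the two eigenspaces of $Y$ are disjoint.\<close>
lemma eigenvector_shift_involution:
  fixes A Y :: "real mat"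
  assumes A: "A \<in> carrier_mat n n" and Y: "Y \<in> carrier_mat n n"
    and YY: "Y * Y = 1\<^sub>m n" and AY: "A * Y = Y * A"
    and c: "\<And>k. eigenvalue A k \<Longrightarrow> \<bar>k\<bar> < c"
    and p: "eigenvector (A + c \<cdot>\<^sub>m Y) p d"
  shows "(Y *\<^sub>v p = p \<or> Y *\<^sub>v p = - p) \<and> (\<exists>k. eigenvector A p k)"
proof -
  have pc: "p \<in> carrier_vec n" "p \<noteq> 0\<^sub>v n"
    using p A Y by (auto simp: eigenvector_def)
  define q where "q = Y *\<^sub>v p"
  have qc: "q \<in> carrier_vec n" using Y pc by (simp add: q_def)
  have Yq: "Y *\<^sub>v q = p" unfolding q_def
    using Y pc YY by (simp flip: assoc_mult_mat_vec[of Y n n Y n p])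
  have Ac: "A *\<^sub>v p \<in> carrier_vec n" "A *\<^sub>v q \<in> carrier_vec n" using A pc qc by auto
  have "(A + c \<cdot>\<^sub>m Y) *\<^sub>v p = d \<cdot>\<^sub>v p" using p by (simp add: eigenvector_def)
  hence *: "A *\<^sub>v p + c \<cdot>\<^sub>v q = d \<cdot>\<^sub>v p"
    using A Y pc by (simp add: add_mult_distrib_mat_vec[of _ n n] q_def smult_mat_mult_vec[of _ n n])
  have Ap: "A *\<^sub>v p = d \<cdot>\<^sub>v p - c \<cdot>\<^sub>v q"
  proof (rule eq_vecI)
    fix i assume "i < dim_vec (d \<cdot>\<^sub>v p - c \<cdot>\<^sub>v q)"
    thus "(A *\<^sub>v p) $ i = (d \<cdot>\<^sub>v p - c \<cdot>\<^sub>v q) $ i"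
      using arg_cong[OF *, of "\<lambda>v. v $ i"] Ac pc qc A by simp
  qed (use A qc in auto)
  have "A *\<^sub>v q = Y *\<^sub>v (A *\<^sub>v p)"
    using assoc_mult_mat_vec[OF A Y pc(1)] assoc_mult_mat_vec[OF Y A pc(1)] by (simp add: q_def AY)
  also have "\<dots> = d \<cdot>\<^sub>v q - c \<cdot>\<^sub>v p"
    using Y pc qc Yq by (simp add: Ap mult_minus_distrib_mat_vec[of _ n n] mult_mat_vec[of _ n n] q_def)
  finally have Aq: "A *\<^sub>v q = d \<cdot>\<^sub>v q - c \<cdot>\<^sub>v p" .
  \<comment> \<open>Up to a factor 2, \<open>p + q\<close> and \<open>p - q\<close> are the
    components of \<open>p\<close> in the eigenspaces of \<open>Y\<close> for 1 and -1. Each of them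
    that is nonzero is an eigenvector of \<open>A\<close>.\<close>
  have plus: "A *\<^sub>v (p + q) = (d - c) \<cdot>\<^sub>v (p + q)"
    using A pc qc by (simp add: mult_add_distrib_mat_vec[of _ n n] Ap Aq)
      (rule eq_vecI, auto simp: algebra_simps)
  have minus: "A *\<^sub>v (p - q) = (d + c) \<cdot>\<^sub>v (p - q)"
    using A pc qc by (simp add: mult_minus_distrib_mat_vec[of _ n n] Ap Aq)
      (rule eq_vecI, auto simp: algebra_simps)
  have "p + q = 0\<^sub>v n \<or> p - q = 0\<^sub>v n"
  proof (rule ccontr)
    assume "\<not> ?thesis"
    hence "eigenvector A (p + q) (d - c)" "eigenvector A (p - q) (d + c)"
      using plus minus A pc qc by (auto simp: eigenvector_def)
    hence "eigenvalue A (d - c)" "eigenvalue A (d + c)" by (auto simp: eigenvalue_def)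
    \<comment> \<open>Two eigenvalues of \<open>A\<close> at distance \<open>2 * c\<close> cannot
      both lie strictly between \<open>- c\<close> and \<open>c\<close>.\<close>
    thus False using c[of "d - c"] c[of "d + c"] by linarith
  qed
  thus ?thesis
  proof
    assume 0: "p + q = 0\<^sub>v n"
    have "q = - p"
    proof (rule eq_vecI)
      fix i assume "i < dim_vec (- p)"
      thus "q $ i = (- p) $ i" using arg_cong[OF 0, of "\<lambda>v. v $ i"] pc qc by simp
    qed (use pc qc in auto)
    moreover have "A *\<^sub>v p = (d + c) \<cdot>\<^sub>v p" unfolding Ap \<open>q = - p\<close>
      using pc by (intro eq_vecI) (auto simp: algebra_simps)
    ultimately show ?thesis using A pc by (auto simp: eigenvector_def q_def)
  next
    assume 0: "p - q = 0\<^sub>v n"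
    have "q = p"
    proof (rule eq_vecI)
      fix i assume "i < dim_vec p"
      thus "q $ i = p $ i" using arg_cong[OF 0, of "\<lambda>v. v $ i"] pc qc by simp
    qed (use pc qc in auto)
    moreover have "A *\<^sub>v p = (d - c) \<cdot>\<^sub>v p" unfolding Ap \<open>q = p\<close>
      using pc by (intro eq_vecI) (auto simp: algebra_simps)
    ultimately show ?thesis using A pc by (auto simp: eigenvector_def q_def)
  qed
qed

text \<open>Orthonormality of the columns comes from diagonalising the single matrix
  \<open>M\<close>. Their symmetry type and their being eigenvectors of \<open>T\<close> are read
  off one column at a time.\<close>

lemma orthonormal_eigenbasis_sym_skew:
  assumes toep: "toeplitz_mat n T" and sym: "symmetric_mat T"
  shows "\<exists>P. P \<in> carrier_mat n n \<and> P\<^sup>T * P = 1\<^sub>m n \<and>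
    (\<forall>i<n. (symmetric_vec n (col P i) \<or> skew_symmetric_vec n (col P i)) \<and>
      (\<exists>k. eigenvector T (col P i) k))"
proof -
  let ?Y = "flip_mat n"
  have T: "T \<in> carrier_mat n n" using toep by (simp add: toeplitz_mat_def)
  obtain c where c: "\<And>k. eigenvalue T k \<Longrightarrow> \<bar>k\<bar> < c"
    using finite_eigenvalues_bound[OF T] by blast
  define M where "M = T + c \<cdot>\<^sub>m ?Y"
  have M: "M \<in> carrier_mat n n" using T by (simp add: M_def)
  have "M\<^sup>T = T\<^sup>T + c \<cdot>\<^sub>m ?Y\<^sup>T" unfolding M_def using T by (intro eq_matI) auto
  hence "M\<^sup>T = M" using sym by (simp add: M_def symmetric_mat_def flip_mat_transpose)
  then obtain P D where P: "P \<in> carrier_mat n n" and D: "D \<in> carrier_mat n n"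
    and PP: "P\<^sup>T * P = 1\<^sub>m n" and Dd: "diagonal_mat D" and MP: "M * P = P * D"
    using real_symmetric_diagonalization[OF M] by blast
  have "eigenvector M (col P i) (D $$ (i,i))" if i: "i < n" for i
  proof -
    have "M *\<^sub>v col P i = col (P * D) i" by (simp only: MP[symmetric] col_mult2[OF M P i])
    also have "\<dots> = D $$ (i,i) \<cdot>\<^sub>v col P i"
    proof (rule eq_vecI)
      fix j assume "j < dim_vec (D $$ (i,i) \<cdot>\<^sub>v col P i)"
      hence j: "j < n" using P by simp
      have "col (P * D) i $ j = (\<Sum>k = 0..<n. P $$ (j,k) * D $$ (k,i))"
        using P D i j by (simp add: scalar_prod_def)
      also have "\<dots> = (\<Sum>k = 0..<n. if k = i then P $$ (j,i) * D $$ (i,i) else 0)"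
        using Dd D i by (intro sum.cong) (auto simp: diagonal_mat_def)
      finally show "col (P * D) i $ j = (D $$ (i,i) \<cdot>\<^sub>v col P i) $ j"
        using P i j by simp
    qed (use P D in auto)
    finally have "M *\<^sub>v col P i = D $$ (i,i) \<cdot>\<^sub>v col P i" .
    moreover have "col P i \<noteq> 0\<^sub>v n"
    proof
      assume "col P i = 0\<^sub>v n"
      thus False using arg_cong[OF PP, of "\<lambda>X. X $$ (i,i)"] P i by simp
    qed
    ultimately show ?thesis using M P i by (simp add: eigenvector_def carrier_vecI)
  qed
  hence "(?Y *\<^sub>v col P i = col P i \<or> ?Y *\<^sub>v col P i = - col P i) \<and> (\<exists>k. eigenvector T (col P i) k)"
    if "i < n" for i
    using eigenvector_shift_involution[OF T flip_mat_carrier flip_mat_square flip_mat_commute[OF toep sym] c]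
      that unfolding M_def by blast
  thus ?thesis using P PP
    by (intro exI[of _ P]) (auto simp: symmetric_vec_def skew_symmetric_vec_def carrier_vecI)
qed

section \<open>Counting symmetric and skew-symmetric columns\<close>

text \<open>The trace of \<open>P\<^sup>T * (flip_mat n * P)\<close> is computed twice. Its diagonal
  entries are 1 on \<open>I\<close> and -1 on \<open>J\<close>, giving
  \<open>card I - card J\<close>; cyclic invariance gives the trace of the flip matrix,
  \<open>n mod 2\<close>. Together with \<open>card I + card J = n\<close> this fixes both
  cardinalities.\<close>

lemma card_sym_skew:
  assumes P: "P \<in> carrier_mat n n" and PP: "P\<^sup>T * P = 1\<^sub>m n"
    and I: "I \<inter> J = {}" "I \<union> J = {..<n}"
    and s: "\<And>i. i \<in> I \<Longrightarrow> symmetric_vec n (col P i)"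
    and k: "\<And>i. i \<in> J \<Longrightarrow> skew_symmetric_vec n (col P i)"
  shows "int (card I) = \<lceil>real n / 2\<rceil>" "int (card J) = \<lfloor>real n / 2\<rfloor>"
proof -
  let ?Y = "flip_mat n"
  have fin: "finite I" "finite J" using I(2) by (metis finite_Un finite_lessThan)+
  have PP': "P * P\<^sup>T = 1\<^sub>m n" using mat_mult_left_right_inverse[of "P\<^sup>T" n P] P PP by simp
  have one: "col P i \<bullet> col P i = 1" if "i < n" for i
    using arg_cong[OF PP, of "\<lambda>X. X $$ (i,i)"] P that by simp
  have entry: "(P\<^sup>T * (?Y * P)) $$ (i,i) = col P i \<bullet> (?Y *\<^sub>v col P i)" if "i < n" for i
    using P that by (simp add: col_mult2[of _ n n _ n])
  have I1: "(P\<^sup>T * (?Y * P)) $$ (i,i) = 1" if "i \<in> I" for i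
  proof -
    have "i < n" using that I by auto
    thus ?thesis using s[OF that] entry one by (simp add: symmetric_vec_def del: index_mult_mat(1))
  qed
  have J1: "(P\<^sup>T * (?Y * P)) $$ (i,i) = - 1" if "i \<in> J" for i
  proof -
    have "i < n" using that I by auto
    thus ?thesis using k[OF that] entry one by (simp add: skew_symmetric_vec_def del: index_mult_mat(1))
  qed
  have "real (n mod 2) = (\<Sum>i<n. (?Y * (P * P\<^sup>T)) $$ (i,i))"
    by (simp add: PP' sum_diag_flip_mat right_mult_one_mat[of _ n n] del: index_mult_mat(1))
  also have "\<dots> = (\<Sum>i<n. ((?Y * P) * P\<^sup>T) $$ (i,i))"
    using P by (simp add: assoc_mult_mat[of _ n n _ n _ n] del: index_mult_mat(1))
  also have "\<dots> = (\<Sum>i<n. (P\<^sup>T * (?Y * P)) $$ (i,i))"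
    by (rule sum_diag_mult_commute) (use P in auto)
  also have "\<dots> = (\<Sum>i\<in>I. (P\<^sup>T * (?Y * P)) $$ (i,i)) + (\<Sum>i\<in>J. (P\<^sup>T * (?Y * P)) $$ (i,i))"
    using I fin by (simp add: sum.union_disjoint[symmetric] del: index_mult_mat(1))
  also have "\<dots> = real (card I) - real (card J)"
    by (simp add: I1 J1 del: index_mult_mat(1))
  finally have diff: "card I = card J + n mod 2" by linarith
  have "card I + card J = n" using I fin by (metis card_Un_disjoint card_lessThan)
  with diff show "int (card I) = \<lceil>real n / 2\<rceil>" "int (card J) = \<lfloor>real n / 2\<rfloor>"
    by linarith+
qed

section \<open>The eigenbasis of T and the eigenpairs of H\<close>

theorem theorem6:
  fixes n :: nat and T H :: "real mat"
  assumes "toeplitz_mat n T"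
    and "symmetric_mat T"
    and "H = flip_mat n * T"
  shows "(\<exists>B. orthonormal_basis_Rn n B \<and> (\<forall>v\<in>B. \<exists>k. eigenvector T v k) \<and>
            (\<exists>S K. B = S \<union> K \<and> S \<inter> K = {} \<and>
               int (card S) = \<lceil>real n / 2\<rceil> \<and> (\<forall>v\<in>S. symmetric_vec n v) \<and>
               int (card K) = \<lfloor>real n / 2\<rfloor> \<and> (\<forall>v\<in>K. skew_symmetric_vec n v)))
       \<and> (\<forall>(v :: nat \<Rightarrow> real vec) (lam :: nat \<Rightarrow> real).
            basis_Rn n (v ` {1..n}) \<longrightarrow>
            (\<forall>i\<in>{1..n}. T *\<^sub>v v i = lam i \<cdot>\<^sub>v v i) \<longrightarrow>
            (\<forall>i\<in>{1..n}. odd i \<longrightarrow> symmetric_vec n (v i)) \<longrightarrow>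
            (\<forall>i\<in>{1..n}. even i \<longrightarrow> skew_symmetric_vec n (v i)) \<longrightarrow>
            (\<forall>i\<in>{1..n}. eigenvector H (v i) ((-1) ^ (i + 1) * lam i)) \<and>
            char_poly H = (\<Prod>i = 1..n. [: - ((-1) ^ (i + 1) * lam i), 1 :]))"
proof (intro conjI allI impI)
  obtain P where P: "P \<in> carrier_mat n n" and PP: "P\<^sup>T * P = 1\<^sub>m n"
    and sk: "\<And>i. i < n \<Longrightarrow> symmetric_vec n (col P i) \<or> skew_symmetric_vec n (col P i)"
    and ev: "\<And>i. i < n \<Longrightarrow> \<exists>k. eigenvector T (col P i) k"
    using orthonormal_eigenbasis_sym_skew[OF assms(1,2)] by blast
  define I where "I = {i. i < n \<and> symmetric_vec n (col P i)}"
  \<comment> \<open>Taking the complement of \<open>I\<close> makes the partition of the indices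
    immediate; skew-symmetry on \<open>J\<close> follows from the dichotomy
    \<open>sk\<close>.\<close>
  define J where "J = {i. i < n \<and> \<not> symmetric_vec n (col P i)}"
  have IJ: "I \<inter> J = {}" "I \<union> J = {..<n}" by (auto simp: I_def J_def)
  have S: "symmetric_vec n (col P i)" if "i \<in> I" for i using that by (simp add: I_def)
  have K: "skew_symmetric_vec n (col P i)" if "i \<in> J" for i using that sk by (auto simp: J_def)
  note cards = card_sym_skew[OF P PP IJ S K]
  note basis = orthogonal_mat_cols_basis[OF P PP]
  \<comment> \<open>Injectivity carries disjointness and cardinalities over from index sets to sets
    of vectors.\<close>
  have inj: "inj_on (col P) {..<n}"
    using basis(1) P by (auto simp: inj_on_def distinct_conv_nth)
  have cols: "set (cols P) = col P ` {..<n}" using P by (auto simp: cols_def)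
  show "\<exists>B. orthonormal_basis_Rn n B \<and> (\<forall>v\<in>B. \<exists>k. eigenvector T v k) \<and>
            (\<exists>S K. B = S \<union> K \<and> S \<inter> K = {} \<and>
               int (card S) = \<lceil>real n / 2\<rceil> \<and> (\<forall>v\<in>S. symmetric_vec n v) \<and>
               int (card K) = \<lfloor>real n / 2\<rfloor> \<and> (\<forall>v\<in>K. skew_symmetric_vec n v))"
  proof (intro exI conjI)
    show "orthonormal_basis_Rn n (col P ` {..<n})" using basis(2) by (simp add: cols)
    show "\<forall>v\<in>col P ` {..<n}. \<exists>k. eigenvector T v k" using ev by auto
    show "col P ` {..<n} = col P ` I \<union> col P ` J" using IJ by blast
    show "col P ` I \<inter> col P ` J = {}"
      using inj_on_image_Int[OF inj, of I J] IJ by auto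
    have "inj_on (col P) I" "inj_on (col P) J" using inj IJ by (auto intro: inj_on_subset)
    thus "int (card (col P ` I)) = \<lceil>real n / 2\<rceil>" "int (card (col P ` J)) = \<lfloor>real n / 2\<rfloor>"
      using cards by (simp_all add: card_image)
  qed (use S K in auto)
next
  fix v :: "nat \<Rightarrow> real vec" and lam :: "nat \<Rightarrow> real"
  assume b: "basis_Rn n (v ` {1..n})"
    and ev: "\<forall>i\<in>{1..n}. T *\<^sub>v v i = lam i \<cdot>\<^sub>v v i"
    and s: "\<forall>i\<in>{1..n}. odd i \<longrightarrow> symmetric_vec n (v i)"
    and k: "\<forall>i\<in>{1..n}. even i \<longrightarrow> skew_symmetric_vec n (v i)"
  have T: "T \<in> carrier_mat n n" using assms(1) by (simp add: toeplitz_mat_def)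
  have H: "H \<in> carrier_mat n n" using T by (simp add: assms(3) mult_carrier_mat[of _ n n])
  \<comment> \<open>Here \<open>T\<close> scales \<open>v i\<close> by \<open>lam i\<close>, and the
    flip matrix then contributes the sign: 1 for odd \<open>i\<close> and -1 for even
    \<open>i\<close>, which is \<open>(-1) ^ (i + 1)\<close>.\<close>
  have Hv: "H *\<^sub>v v i = ((-1) ^ (i + 1) * lam i) \<cdot>\<^sub>v v i" if i: "i \<in> {1..n}" for i
  proof -
    have vc: "v i \<in> carrier_vec n"
      using s k i by (cases "odd i") (auto simp: symmetric_vec_def skew_symmetric_vec_def)
    have "flip_mat n *\<^sub>v v i = (-1) ^ (i + 1) \<cdot>\<^sub>v v i"
    proof (cases "odd i")
      case True
      thus ?thesis using s i by (simp add: symmetric_vec_def)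
    next
      case False
      thus ?thesis using k i vc by (intro eq_vecI) (simp_all add: skew_symmetric_vec_def)
    qed
    moreover have "H *\<^sub>v v i = flip_mat n *\<^sub>v (lam i \<cdot>\<^sub>v v i)"
      using T vc i ev by (simp add: assms(3) assoc_mult_mat_vec[of _ n n _ n])
    ultimately show ?thesis
      using vc by (simp add: mult_mat_vec[of _ n n] smult_smult_assoc mult.commute)
  qed
  show "\<forall>i\<in>{1..n}. eigenvector H (v i) ((-1) ^ (i + 1) * lam i)"
    using char_poly_eigenvector_basis(2)[OF H b Hv] by blast
  show "char_poly H = (\<Prod>i = 1..n. [: - ((-1) ^ (i + 1) * lam i), 1 :])"
    using char_poly_eigenvector_basis(1)[OF H b Hv] .
qed

end
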